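(* Let $\{g_i\}_{i=1}^\infty$ be a general pre-Fréchet frame for $X_F$ with respect to $\Theta_F$ and let $\Theta_s$, $s\in\mathbb N_0$, be $CB$-spaces. Assume that there exists a continuous operator $V:\Theta_F\to X_F$ such that $V\{g_i(f)\}_{i=1}^\infty=f$ for all $f\in X_F$. Then there exist sequences $\{w_j\}_{j\in\mathbb N_0}$, $\{r_j\}_{j\in\mathbb N_0}$, $\{\widetilde w_j\}_{j\in\mathbb N_0}$ in $\mathbb N_0$ which increase to $\infty$, and constants $\widetilde A_j,\widetilde B_j>0$, $j\in\mathbb N_0$, such that for every $j\in\mathbb N_0$, $$\widetilde A_j\|f\|_{w_j}\le|||\{g_i(f)\}_{i=1}^\infty|||_{r_j}\le\widetilde B_j\|f\|_{\widetilde w_j},\quad\forall f\in X_F.$$ Moreover, there exists a sequence $\{f_i\}_{i=1}^\infty$ in $X_F$ such that for every $j\in\mathbb N_0$, $\{f_i\}_{i=1}^\infty$ is a $\Theta_{r_j}^*$-Bessel sequence for $X_{w_j}^*$ and $$f=\sum_{i=1}^\infty g_i^{\widetilde w_j}(f)f_i\ \text{ in } \|\cdot\|_{w_j}\text{-norm},\quad\text{for every } f\in X_{\widetilde w_j}.$$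
   Context: Linear mappings are called operators. $\mathbb N_0=\{0,1,2,\dots\}$; $e_i=\{\delta_{ki}\}_{k=1}^\infty$ is the $i$-th canonical vector. A $BK$-space is a Banach space of scalar sequences on which all coordinate functionals are continuous. A $CB$-space is a $BK$-space for which the canonical vectors form a Schauder basis. If $\Theta$ is a $CB$-space, its dual $\Theta^*$ is always identified with the $BK$-space $\Theta^{\circledast}=\{\{h(e_i)\}_{i=1}^\infty: h\in\Theta^*\}$ normed by $|||\{h(e_i)\}_{i=1}^\infty|||_{\Theta^\circledast}=\|h\|_{\Theta^*}$. Admissible scale: a sequence $\{(Y_s,|\cdot|_s)\}_{s\in\mathbb N_0}$ of separable Banach spaces such that $\{0\}\ne\bigcap_{s\in\mathbb N_0}Y_s\subseteq\dots\subseteq Y_2\subseteq Y_1\subseteq Y_0$; $|\cdot|_0\le|\cdot|_1\le|\cdot|_2\le\cdots$ (each inequality on the smaller space); and $Y_F:=\bigcap_{s\in\mathbb N_0}Y_s$ is dense in $Y_s$ for every $s\in\mathbb N_0$. $Y_F$ is a Fréchet space with the sequence of norms $|\cdot|_s$, $s\in\mathbb N_0$. Throughout, $X_F=\bigcap_s X_s$ is the Fréchet space of an admissible scale $\{(X_s,\|\cdot\|_s)\}_{s\in\mathbb N_0}$, and $\Theta_F=\bigcap_s\Theta_s$ is the Fréchet space of an admissible scale $\{(\Theta_s,|||\cdot|||_s)\}_{s\in\mathbb N_0}$ of $BK$-spaces. $X_F^*$ is the topological dual of $X_F$. A sequence $\{g_i\}_{i=1}^\infty$ in $X_F^*$ is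 a general pre-Fréchet frame for $X_F$ with respect to $\Theta_F$ if there exist sequences $\{\widetilde s_k\}_{k\in\mathbb N_0},\{s_k\}_{k\in\mathbb N_0}\subseteq\mathbb N_0$ which increase to $\infty$, with $s_k\le\widetilde s_k$ for all $k\in\mathbb N_0$, and constants $A_k,B_k>0$, $k\in\mathbb N_0$, such that for all $f\in X_F$ and all $k\in\mathbb N_0$: $\{g_i(f)\}_{i=1}^\infty\in\Theta_F$ and $A_k\|f\|_{s_k}\le|||\{g_i(f)\}_{i=1}^\infty|||_k\le B_k\|f\|_{\widetilde s_k}$. $g_i^{\widetilde w_j}$ denotes the unique continuous extension of $g_i$ from $X_F$ to $X_{\widetilde w_j}$ (it exists because of the upper inequality in the claim and the density of $X_F$ in $X_{\widetilde w_j}$). A sequence $\{f_i\}_{i=1}^\infty$ in $X_F$ is a $\Theta_r^*$-Bessel sequence for $X_w^*$ if there is $B<\infty$ such that for all $g\in X_w^*$, $\{g(f_i)\}_{i=1}^\infty\in\Theta_r^*$ and $|||\{g(f_i)\}_{i=1}^\infty|||_{\Theta_r^*}\le B\|g\|_{X_w^*}$. *)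

theory Defs
  imports "HOL-Analysis.Analysis" "HOL-Library.Function_Algebras"
begin

text \<open>
  The scalar field is a type \<open>'k :: {real_normed_field, banach}\<close>; by the Gelfand-Mazur theorem
  this is \<open>\<real>\<close> or \<open>\<complex>\<close>.  The spaces of a scale carry different norms and are nested, so
  a normed space is given by a carrier \<open>Y\<close> in an ambient vector space with scalar multiplication
  \<open>sc\<close>, together with a norm function \<open>n\<close> of which only the values on \<open>Y\<close> matter.
\<close>

definition linear_on ::
  "('k::field \<Rightarrow> 'a::ab_group_add \<Rightarrow> 'a) \<Rightarrow> ('k \<Rightarrow> 'b::ab_group_add \<Rightarrow> 'b) \<Rightarrow> 'a set \<Rightarrow> ('a \<Rightarrow> 'b) \<Rightarrow> bool"
  where "linear_on sc1 sc2 S T \<longleftrightarrow>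
    (\<forall>x\<in>S. \<forall>y\<in>S. T (x + y) = T x + T y) \<and> (\<forall>c. \<forall>x\<in>S. T (sc1 c x) = sc2 c (T x))"

definition normed_space_on ::
  "('k::real_normed_field \<Rightarrow> 'a::ab_group_add \<Rightarrow> 'a) \<Rightarrow> 'a set \<Rightarrow> ('a \<Rightarrow> real) \<Rightarrow> bool"
  where "normed_space_on sc Y n \<longleftrightarrow>
    vector_space sc \<and> module.subspace sc Y \<and>
    (\<forall>x\<in>Y. 0 \<le> n x) \<and>
    (\<forall>x\<in>Y. n x = 0 \<longleftrightarrow> x = 0) \<and>
    (\<forall>c. \<forall>x\<in>Y. n (sc c x) = norm c * n x) \<and>
    (\<forall>x\<in>Y. \<forall>y\<in>Y. n (x + y) \<le> n x + n y)"

text \<open>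
  The locale \<open>Metric_space\<close> requires nonnegativity and symmetry of the distance also outside
  the carrier, hence the case distinction.
\<close>

definition norm_dist :: "'a::ab_group_add set \<Rightarrow> ('a \<Rightarrow> real) \<Rightarrow> 'a \<Rightarrow> 'a \<Rightarrow> real"
  where "norm_dist Y n x y = (if x \<in> Y \<and> y \<in> Y then n (x - y) else 0)"

lemma Metric_space_norm_dist:
  assumes "normed_space_on sc Y n"
  shows "Metric_space Y (norm_dist Y n)"
proof -
  interpret vector_space sc using assms by (simp add: normed_space_on_def)
  have sub: "subspace Y" and pos: "\<And>x. x \<in> Y \<Longrightarrow> 0 \<le> n x"
    and zero: "\<And>x. x \<in> Y \<Longrightarrow> n x = 0 \<longleftrightarrow> x = 0"
    and hom: "\<And>c x. x \<in> Y \<Longrightarrow> n (sc c x) = norm c * n x"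
    and tri: "\<And>x y. x \<in> Y \<Longrightarrow> y \<in> Y \<Longrightarrow> n (x + y) \<le> n x + n y"
    using assms by (auto simp: normed_space_on_def)
  have diff: "x - y \<in> Y" if "x \<in> Y" "y \<in> Y" for x y
    using that sub subspace_diff by blast
  show ?thesis
  proof
    fix x y show "0 \<le> norm_dist Y n x y" by (simp add: norm_dist_def pos diff)
  next
    fix x y show "norm_dist Y n x y = norm_dist Y n y x"
      using hom[of "x - y" "-1"] diff by (auto simp: norm_dist_def)
  next
    fix x y assume "x \<in> Y" "y \<in> Y"
    then show "norm_dist Y n x y = 0 \<longleftrightarrow> x = y" by (simp add: norm_dist_def zero diff)
  next
    fix x y z assume "x \<in> Y" "y \<in> Y" "z \<in> Y"
    then show "norm_dist Y n x z \<le> norm_dist Y n x y + norm_dist Y n y z"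
      using tri[of "x - y" "y - z"] diff by (simp add: norm_dist_def)
  qed
qed

definition norm_topology :: "'a::ab_group_add set \<Rightarrow> ('a \<Rightarrow> real) \<Rightarrow> 'a topology"
  where "norm_topology Y n = Metric_space.mtopology Y (norm_dist Y n)"

definition banach_space_on ::
  "('k::real_normed_field \<Rightarrow> 'a::ab_group_add \<Rightarrow> 'a) \<Rightarrow> 'a set \<Rightarrow> ('a \<Rightarrow> real) \<Rightarrow> bool"
  where "banach_space_on sc Y n \<longleftrightarrow>
    normed_space_on sc Y n \<and> Metric_space.mcomplete Y (norm_dist Y n)"

text \<open>
  Continuous linear functionals on the carrier \<open>topspace T\<close>.  Their values outside the carrier are
  unconstrained, so a functional on the carrier has in general several representatives.
\<close>

definition topological_dual ::
  "('k::real_normed_field \<Rightarrow> 'a::ab_group_add \<Rightarrow> 'a) \<Rightarrow> 'a topology \<Rightarrow> ('a \<Rightarrow> 'k) set"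
  where "topological_dual sc T =
    {h. linear_on sc (*) (topspace T) h \<and> continuous_map T euclidean h}"

definition dual_norm :: "'a set \<Rightarrow> ('a \<Rightarrow> real) \<Rightarrow> ('a \<Rightarrow> 'k::real_normed_field) \<Rightarrow> real"
  where "dual_norm Y n h = (SUP y\<in>{y \<in> Y. n y \<le> 1}. norm (h y))"

definition schauder_basis ::
  "('k::real_normed_field \<Rightarrow> 'a::ab_group_add \<Rightarrow> 'a) \<Rightarrow> 'a set \<Rightarrow> ('a \<Rightarrow> real) \<Rightarrow> (nat \<Rightarrow> 'a) \<Rightarrow> bool"
  where "schauder_basis sc Y n b \<longleftrightarrow> range b \<subseteq> Y \<and>
    (\<forall>x\<in>Y. \<exists>!c. limitin (norm_topology Y n) (\<lambda>N. \<Sum>i<N. sc (c i) (b i)) x sequentially)"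

text \<open>
  Scalar sequences are functions \<open>nat \<Rightarrow> 'k\<close> with the pointwise operations of
  \<open>HOL-Library.Function_Algebras\<close>; indices start at 0 instead of 1.
\<close>

definition seq_scale :: "'k::field \<Rightarrow> (nat \<Rightarrow> 'k) \<Rightarrow> nat \<Rightarrow> 'k"
  where "seq_scale c x = (\<lambda>i. c * x i)"

lemma vector_space_seq_scale: "vector_space seq_scale"
  by unfold_locales (auto simp: seq_scale_def fun_eq_iff algebra_simps)

definition canonical_vector :: "nat \<Rightarrow> nat \<Rightarrow> 'k::field"
  where "canonical_vector i = (\<lambda>k. if k = i then 1 else 0)"

definition BK_space :: "(nat \<Rightarrow> 'k::real_normed_field) set \<Rightarrow> ((nat \<Rightarrow> 'k) \<Rightarrow> real) \<Rightarrow> bool"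
  where "BK_space Y n \<longleftrightarrow> banach_space_on seq_scale Y n \<and>
    (\<forall>i. continuous_map (norm_topology Y n) euclidean (\<lambda>d. d i))"

definition CB_space :: "(nat \<Rightarrow> 'k::real_normed_field) set \<Rightarrow> ((nat \<Rightarrow> 'k) \<Rightarrow> real) \<Rightarrow> bool"
  where "CB_space Y n \<longleftrightarrow> BK_space Y n \<and> schauder_basis seq_scale Y n canonical_vector"

text \<open>
  The dual of a \<open>CB\<close>-space as a sequence space.  The functional \<open>h\<close> selected in the norm is
  determined on \<open>Y\<close> because the canonical vectors form a basis.
\<close>

definition dual_seq_space ::
  "(nat \<Rightarrow> 'k::real_normed_field) set \<Rightarrow> ((nat \<Rightarrow> 'k) \<Rightarrow> real) \<Rightarrow> (nat \<Rightarrow> 'k) set"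
  where "dual_seq_space Y n =
    (\<lambda>h i. h (canonical_vector i)) ` topological_dual seq_scale (norm_topology Y n)"

definition dual_seq_norm ::
  "(nat \<Rightarrow> 'k::real_normed_field) set \<Rightarrow> ((nat \<Rightarrow> 'k) \<Rightarrow> real) \<Rightarrow> (nat \<Rightarrow> 'k) \<Rightarrow> real"
  where "dual_seq_norm Y n d = dual_norm Y n
    (SOME h. h \<in> topological_dual seq_scale (norm_topology Y n) \<and>
             (\<lambda>i. h (canonical_vector i)) = d)"

definition frechet_carrier :: "(nat \<Rightarrow> 'a set) \<Rightarrow> 'a set"
  where "frechet_carrier Y = (\<Inter>s. Y s)"

definition admissible_scale ::
  "('k::real_normed_field \<Rightarrow> 'a::ab_group_add \<Rightarrow> 'a) \<Rightarrow> (nat \<Rightarrow> 'a set) \<Rightarrow> (nat \<Rightarrow> 'a \<Rightarrow> real) \<Rightarrow> bool"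
  where "admissible_scale sc Y n \<longleftrightarrow>
    (\<forall>s. banach_space_on sc (Y s) (n s) \<and> separable_space (norm_topology (Y s) (n s))) \<and>
    frechet_carrier Y \<noteq> {0} \<and>
    (\<forall>s. Y (Suc s) \<subseteq> Y s) \<and>
    (\<forall>s. \<forall>x\<in>Y (Suc s). n s x \<le> n (Suc s) x) \<and>
    (\<forall>s. norm_topology (Y s) (n s) closure_of frechet_carrier Y = Y s)"

definition frechet_topology :: "(nat \<Rightarrow> 'a::ab_group_add set) \<Rightarrow> (nat \<Rightarrow> 'a \<Rightarrow> real) \<Rightarrow> 'a topology"
  where "frechet_topology Y n = topology_generated_by
    {{y \<in> frechet_carrier Y. n s (y - x) < \<epsilon>} | s x \<epsilon>. x \<in> frechet_carrier Y \<and> 0 < \<epsilon>}"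

lemma topspace_frechet_topology:
  assumes "admissible_scale sc Y n"
  shows "topspace (frechet_topology Y n) = frechet_carrier Y"
proof -
  have "x \<in> topspace (frechet_topology Y n)" if x: "x \<in> frechet_carrier Y" for x
  proof -
    have ns: "normed_space_on sc (Y 0) (n 0)"
      using assms by (auto simp: admissible_scale_def banach_space_on_def)
    then interpret vector_space sc by (simp add: normed_space_on_def)
    have "0 \<in> Y 0" using ns subspace_0 by (auto simp: normed_space_on_def)
    then have "n 0 0 = 0" using ns unfolding normed_space_on_def by blast
    then have "n 0 (x - x) < 1" by simp
    then have "x \<in> {y \<in> frechet_carrier Y. n 0 (y - x) < 1}" using x by simp
    then show ?thesis
      unfolding frechet_topology_def topology_generated_by_topspace using x zero_less_one by blast
  qed
  then show ?thesis
    by (auto simp: frechet_topology_def topology_generated_by_topspace)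
qed

definition increases_to_infinity :: "(nat \<Rightarrow> nat) \<Rightarrow> bool"
  where "increases_to_infinity s \<longleftrightarrow> mono s \<and> filterlim s at_top sequentially"

definition general_pre_frechet_frame ::
  "('k::real_normed_field \<Rightarrow> 'a::ab_group_add \<Rightarrow> 'a) \<Rightarrow> (nat \<Rightarrow> 'a set) \<Rightarrow> (nat \<Rightarrow> 'a \<Rightarrow> real) \<Rightarrow>
   (nat \<Rightarrow> (nat \<Rightarrow> 'k) set) \<Rightarrow> (nat \<Rightarrow> (nat \<Rightarrow> 'k) \<Rightarrow> real) \<Rightarrow> (nat \<Rightarrow> 'a \<Rightarrow> 'k) \<Rightarrow> bool"
  where "general_pre_frechet_frame sc X nX \<Theta> n\<Theta> g \<longleftrightarrow>
    (\<forall>i. g i \<in> topological_dual sc (frechet_topology X nX)) \<and>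
    (\<exists>st s. increases_to_infinity st \<and> increases_to_infinity s \<and> (\<forall>k. s k \<le> st k) \<and>
      (\<exists>A B. (\<forall>k. 0 < A k \<and> 0 < B k) \<and>
        (\<forall>f\<in>frechet_carrier X. \<forall>k.
          (\<lambda>i. g i f) \<in> frechet_carrier \<Theta> \<and>
          A k * nX (s k) f \<le> n\<Theta> k (\<lambda>i. g i f) \<and>
          n\<Theta> k (\<lambda>i. g i f) \<le> B k * nX (st k) f)))"

definition continuous_extension ::
  "('k::real_normed_field \<Rightarrow> 'a::ab_group_add \<Rightarrow> 'a) \<Rightarrow> 'a set \<Rightarrow> 'a topology \<Rightarrow> ('a \<Rightarrow> 'k) \<Rightarrow> ('a \<Rightarrow> 'k) \<Rightarrow> bool"
  where "continuous_extension sc S T h H \<longleftrightarrow>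
    H \<in> topological_dual sc T \<and> (\<forall>x\<in>S. H x = h x)"

definition dual_bessel_sequence ::
  "('k::real_normed_field \<Rightarrow> 'a::ab_group_add \<Rightarrow> 'a) \<Rightarrow> 'a set \<Rightarrow> ('a \<Rightarrow> real) \<Rightarrow>
   (nat \<Rightarrow> 'k) set \<Rightarrow> ((nat \<Rightarrow> 'k) \<Rightarrow> real) \<Rightarrow> (nat \<Rightarrow> 'a) \<Rightarrow> bool"
  where "dual_bessel_sequence sc X nX \<Theta> n\<Theta> f \<longleftrightarrow>
    (\<exists>B. \<forall>g\<in>topological_dual sc (norm_topology X nX).
      (\<lambda>i. g (f i)) \<in> dual_seq_space \<Theta> n\<Theta> \<and>
      dual_seq_norm \<Theta> n\<Theta> (\<lambda>i. g (f i)) \<le> B * dual_norm X nX g)"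

end

theory Submission
  imports Defs
begin

text \<open>
  Continuity of \<open>V\<close> bounds \<open>\<parallel>V d\<parallel>\<close> in \<open>X\<^sub>j\<close> by the norm of \<open>d\<close> in some \<open>\<Theta>\<^bsub>r(j)\<^esub>\<close>, and the upper frame
  inequality bounds the norm of \<open>{g\<^sub>i(f)}\<close> in \<open>\<Theta>\<^bsub>r(j)\<^esub>\<close> by the norm of \<open>f\<close> in some \<open>X\<^bsub>wt(j)\<^esub>\<close> with
  \<open>wt(j) \<ge> j\<close>.  By density, \<open>V\<close> and \<open>f \<mapsto> {g\<^sub>i(f)}\<close> extend to bounded operators
  \<open>V' : \<Theta>\<^bsub>r(j)\<^esub> \<rightarrow> X\<^sub>j\<close> and \<open>U : X\<^bsub>wt(j)\<^esub> \<rightarrow> \<Theta>\<^bsub>r(j)\<^esub>\<close> with \<open>V' \<circ> U\<close> the inclusion.  Applying \<open>V'\<close> to the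
  basis expansion of \<open>U h\<close> gives the series for \<open>h\<close> with \<open>f\<^sub>i = V e\<^sub>i\<close>, and composing a functional
  on \<open>X\<^sub>j\<close> with \<open>V'\<close> gives the Bessel property.
\<close>

section \<open>Norm topology, density and homogeneity on a carrier\<close>

locale normed_carrier =
  fixes sc :: "'k::real_normed_field \<Rightarrow> 'a::ab_group_add \<Rightarrow> 'a" and Y :: "'a set" and n :: "'a \<Rightarrow> real"
  assumes normed: "normed_space_on sc Y n"
begin

sublocale vector_space sc
  using normed by (simp add: normed_space_on_def)

sublocale metric: Metric_space Y "norm_dist Y n"
  by (rule Metric_space_norm_dist[OF normed])

lemma subspace_carrier: "subspace Y"
  using normed by (simp add: normed_space_on_def)

lemma carrier_closed [simp]:
  "0 \<in> Y"
  "x \<in> Y \<Longrightarrow> y \<in> Y \<Longrightarrow> x + y \<in> Y"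
  "x \<in> Y \<Longrightarrow> y \<in> Y \<Longrightarrow> x - y \<in> Y"
  "x \<in> Y \<Longrightarrow> sc c x \<in> Y"
  using subspace_carrier subspace_0 subspace_add subspace_diff subspace_scale by blast+

lemma norm_nonneg [simp]: "x \<in> Y \<Longrightarrow> 0 \<le> n x"
  and norm_eq_0: "x \<in> Y \<Longrightarrow> n x = 0 \<longleftrightarrow> x = 0"
  and norm_scale: "x \<in> Y \<Longrightarrow> n (sc c x) = norm c * n x"
  and norm_triangle: "x \<in> Y \<Longrightarrow> y \<in> Y \<Longrightarrow> n (x + y) \<le> n x + n y"
  using normed by (auto simp: normed_space_on_def)

lemma norm_zero [simp]: "n 0 = 0"
  by (simp add: norm_eq_0)

lemma norm_commute: "x \<in> Y \<Longrightarrow> y \<in> Y \<Longrightarrow> n (x - y) = n (y - x)"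
  using metric.commute[of x y] by (simp add: norm_dist_def)

lemma norm_diff_triangle:
  "x \<in> Y \<Longrightarrow> y \<in> Y \<Longrightarrow> z \<in> Y \<Longrightarrow> n (x - z) \<le> n (x - y) + n (y - z)"
  using norm_triangle[of "x - y" "y - z"] by simp

lemma topspace_norm_topology [simp]: "topspace (norm_topology Y n) = Y"
  by (simp add: norm_topology_def)

lemma mball_norm_dist: "x \<in> Y \<Longrightarrow> metric.mball x e = {y \<in> Y. n (y - x) < e}"
  using norm_commute by (auto simp: metric.mball_def norm_dist_def)

lemma openin_norm_topology:
  "openin (norm_topology Y n) U \<longleftrightarrow> U \<subseteq> Y \<and> (\<forall>x\<in>U. \<exists>e>0. {y \<in> Y. n (y - x) < e} \<subseteq> U)"
  unfolding norm_topology_def metric.openin_mtopology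
  by (metis mball_norm_dist subset_iff)

lemma limitin_norm_topology:
  assumes "\<And>i. f i \<in> Y"
  shows "limitin (norm_topology Y n) f l sequentially \<longleftrightarrow> l \<in> Y \<and> (\<lambda>i. n (f i - l)) \<longlonglongrightarrow> 0"
  unfolding norm_topology_def metric.limitin_metric_dist_null
  using assms by (auto simp: norm_dist_def)

lemma closure_approx:
  assumes "norm_topology Y n closure_of D = Y" "x \<in> Y" "0 < e"
  obtains d where "d \<in> D" "d \<in> Y" "n (d - x) < e"
proof -
  have "x \<in> metric.mtopology closure_of D"
    using assms by (simp add: norm_topology_def)
  then show ?thesis
    using that assms(2,3) mball_norm_dist unfolding metric.metric_closure_of by blast
qed

lemma closure_seq:
  assumes "norm_topology Y n closure_of D = Y" "x \<in> Y"
  obtains a where "\<And>i::nat. a i \<in> D" "\<And>i. a i \<in> Y" "(\<lambda>i. n (a i - x)) \<longlonglongrightarrow> 0"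
proof -
  have "\<exists>d. d \<in> D \<and> d \<in> Y \<and> n (d - x) < 1 / real (Suc i)" for i
    using closure_approx[OF assms, of "1 / real (Suc i)"] by auto
  then obtain a where a: "\<And>i::nat. a i \<in> D" "\<And>i. a i \<in> Y" "\<And>i. n (a i - x) < 1 / real (Suc i)"
    by metis
  have "(\<lambda>i. n (a i - x)) \<longlonglongrightarrow> 0"
  proof (rule tendsto_sandwich[OF _ _ tendsto_const LIMSEQ_Suc[OF lim_1_over_n]])
    show "\<forall>\<^sub>F i in sequentially. 0 \<le> n (a i - x)" using a assms by simp
    show "\<forall>\<^sub>F i in sequentially. n (a i - x) \<le> 1 / of_nat (Suc i)"
      using a(3) less_imp_le by (intro always_eventually allI) fastforce
  qed
  then show ?thesis using that a by blast
qed

text \<open>Homogeneity turns a bound on one ball into a linear bound: rescale a nonzero vector into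
  the ball, apply the bound there and undo the scaling. Stating it for a function \<open>p\<close>
  on a subspace covers both a functional, with \<open>p\<close> the absolute value of
  \<open>h\<close>, and an operator between Frechet spaces, with \<open>p\<close> a single norm of
  \<open>T x\<close>.\<close>

lemma bounded_of_ball:
  assumes D: "subspace D" "D \<subseteq> Y" and "0 < e"
    and p_scale: "\<And>c x. x \<in> D \<Longrightarrow> p (sc c x) = norm c * p x"
    and ball: "\<And>x. x \<in> D \<Longrightarrow> n x < e \<Longrightarrow> p x < 1"
    and "x \<in> D"
  shows "p x \<le> 2 / e * n x"
proof (cases "x = 0")
  case True
  have "p 0 = 0" using p_scale[OF \<open>x \<in> D\<close>, of 0] by simp
  then show ?thesis using True by simp
next
  case False
  have x: "x \<in> Y" using assms by auto
  then have pos: "0 < n x" using False norm_eq_0 norm_nonneg by (metis less_le)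
  \<comment> \<open>The factor 2 places the rescaled vector at norm \<open>e / 2\<close>, strictly
    inside the open ball; it is the 2 in the final constant.\<close>
  let ?c = "of_real (e / (2 * n x)) :: 'k"
  have c: "norm ?c = e / (2 * n x)" using pos \<open>0 < e\<close> by (simp add: norm_divide norm_mult)
  have "n (sc ?c x) < e" unfolding norm_scale[OF x] c using pos \<open>0 < e\<close> by simp
  then have "p (sc ?c x) < 1" using ball D \<open>x \<in> D\<close> subspace_scale by blast
  then have "e / (2 * n x) * p x < 1" by (simp only: p_scale[OF \<open>x \<in> D\<close>] c)
  then show ?thesis using pos \<open>0 < e\<close> by (simp add: field_simps)
qed

end

section \<open>Maps that are linear on a subspace only\<close>

lemma linear_on_simps:
  assumes "linear_on sc1 sc2 S T"
  shows linear_on_add: "x \<in> S \<Longrightarrow> y \<in> S \<Longrightarrow> T (x + y) = T x + T y"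
    and linear_on_scale: "x \<in> S \<Longrightarrow> T (sc1 c x) = sc2 c (T x)"
  using assms by (auto simp: linear_on_def)

context vector_space
begin

lemma linear_on_0:
  assumes "linear_on scale sc2 S T" "subspace S"
  shows "T 0 = 0"
  using linear_on_add[OF assms(1), of 0 0] subspace_0[OF assms(2)] by simp

lemma linear_on_diff:
  assumes "linear_on scale sc2 S T" "subspace S" "x \<in> S" "y \<in> S"
  shows "T (x - y) = T x - T y"
  using linear_on_add[OF assms(1) subspace_diff[OF assms(2-4)] assms(4)] by (simp add: algebra_simps)

lemma linear_on_sum:
  fixes b :: "nat \<Rightarrow> 'b"
  assumes "linear_on scale sc2 S T" "subspace S" "\<And>i. b i \<in> S"
  shows "T (\<Sum>i<N. scale (c i) (b i)) = (\<Sum>i<N. sc2 (c i) (T (b i)))"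
proof (induction N)
  case 0
  then show ?case using linear_on_0[OF assms(1,2)] by simp
next
  case (Suc N)
  have "(\<Sum>i<N. scale (c i) (b i)) \<in> S"
    using assms(2,3) by (intro subspace_sum subspace_scale)
  then show ?case
    using Suc assms by (simp add: linear_on_add[OF assms(1)] linear_on_scale[OF assms(1)] subspace_scale)
qed

end

section \<open>Continuous functionals and the dual norm\<close>

context normed_carrier
begin

text \<open>Continuity at 0 puts a ball into the preimage of the unit ball, and rescaling gives the
  bound; conversely, a linear bound makes \<open>h\<close> Lipschitz on the carrier. All later work
  with duals goes through this criterion.\<close>

lemma topological_dual_norm_topology:
  "h \<in> topological_dual sc (norm_topology Y n) \<longleftrightarrow>
    linear_on sc (*) Y h \<and> (\<exists>C\<ge>0. \<forall>y\<in>Y. norm (h y) \<le> C * n y)"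
proof (intro iffI)
  assume h: "h \<in> topological_dual sc (norm_topology Y n)"
  then have lin: "linear_on sc (*) Y h" and cont: "continuous_map (norm_topology Y n) euclidean h"
    by (auto simp: topological_dual_def)
  have "openin (norm_topology Y n) {x \<in> Y. h x \<in> ball 0 1}"
    using openin_continuous_map_preimage[OF cont, of "ball 0 1"] by simp
  moreover have "h 0 = 0" using linear_on_0[OF lin subspace_carrier] .
  then have "0 \<in> {x \<in> Y. h x \<in> ball 0 1}" by simp
  ultimately obtain e where e: "e > 0" "{y \<in> Y. n (y - 0) < e} \<subseteq> {x \<in> Y. h x \<in> ball 0 1}"
    unfolding openin_norm_topology by meson
  have "norm (h y) \<le> 2 / e * n y" if "y \<in> Y" for y
    by (rule bounded_of_ball[OF subspace_carrier subset_refl \<open>e > 0\<close> _ _ that])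
      (use e(2) in \<open>auto simp: linear_on_scale[OF lin] norm_mult\<close>)
  then show "linear_on sc (*) Y h \<and> (\<exists>C\<ge>0. \<forall>y\<in>Y. norm (h y) \<le> C * n y)"
    using lin e(1) by (intro conjI exI[of _ "2 / e"]) auto
next
  assume "linear_on sc (*) Y h \<and> (\<exists>C\<ge>0. \<forall>y\<in>Y. norm (h y) \<le> C * n y)"
  then obtain C where lin: "linear_on sc (*) Y h" and C: "0 \<le> C" "\<And>y. y \<in> Y \<Longrightarrow> norm (h y) \<le> C * n y"
    by blast
  have "openin (norm_topology Y n) {x \<in> Y. h x \<in> W}" if W: "open W" for W
    unfolding openin_norm_topology
  proof (intro conjI ballI)
    fix x assume x: "x \<in> {x \<in> Y. h x \<in> W}"
    then obtain e where e: "e > 0" "ball (h x) e \<subseteq> W"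
      using openE[OF W, of "h x"] by blast
    \<comment> \<open>Dividing by \<open>C + 1\<close> instead of \<open>C\<close> keeps the radius
      meaningful when \<open>C = 0\<close>.\<close>
    have "h y \<in> W" if y: "y \<in> Y" "n (y - x) < e / (C + 1)" for y
    proof -
      have "norm (h y - h x) \<le> C * n (y - x)"
        using C(2)[of "y - x"] x y linear_on_diff[OF lin subspace_carrier] by simp
      also have "\<dots> \<le> (C + 1) * n (y - x)" using x y by (simp add: algebra_simps)
      also have "\<dots> < e" using y(2) C(1) by (simp add: field_simps)
      finally show ?thesis using e by (auto simp: dist_norm norm_minus_commute)
    qed
    then show "\<exists>e>0. {y \<in> Y. n (y - x) < e} \<subseteq> {x \<in> Y. h x \<in> W}"
      using x e C(1) by (intro exI[of _ "e / (C + 1)"]) auto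
  qed auto
  then show "h \<in> topological_dual sc (norm_topology Y n)"
    using lin by (simp add: topological_dual_def continuous_map_def)
qed

lemma dual_norm_le:
  assumes "\<And>y. y \<in> Y \<Longrightarrow> norm (h y) \<le> C * n y" "0 \<le> C"
  shows "dual_norm Y n h \<le> C"
  unfolding dual_norm_def
proof (rule cSUP_least)
  show "{y \<in> Y. n y \<le> 1} \<noteq> {}" by (auto intro!: exI[of _ 0])
  fix y assume "y \<in> {y \<in> Y. n y \<le> 1}"
  then show "norm (h y) \<le> C"
    using assms(1)[of y] mult_left_mono[of "n y" 1 C] assms(2) by force
qed

text \<open>The dual norm is a real supremum, which dominates the values only if these are bounded;
  continuity supplies the bound.\<close>

lemma bdd_above_dual_norm:
  assumes "h \<in> topological_dual sc (norm_topology Y n)"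
  shows "bdd_above ((\<lambda>y. norm (h y)) ` {y \<in> Y. n y \<le> 1})"
proof -
  obtain C where C: "0 \<le> C" "\<And>y. y \<in> Y \<Longrightarrow> norm (h y) \<le> C * n y"
    using assms unfolding topological_dual_norm_topology by blast
  show ?thesis
  proof (rule bdd_aboveI2)
    fix y assume "y \<in> {y \<in> Y. n y \<le> 1}"
    then show "norm (h y) \<le> C" using C(2)[of y] mult_left_mono[of "n y" 1 C] C(1) by force
  qed
qed

text \<open>A nonzero \<open>y\<close> is normalised to norm 1, where the supremum applies
  directly.\<close>

lemma norm_le_dual_norm:
  assumes h: "h \<in> topological_dual sc (norm_topology Y n)" and "y \<in> Y"
  shows "norm (h y) \<le> dual_norm Y n h * n y"
proof (cases "y = 0")
  case True
  have "h 0 = 0"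
    using h linear_on_0[OF _ subspace_carrier] by (auto simp: topological_dual_norm_topology)
  then show ?thesis using True by simp
next
  case False
  have lin: "linear_on sc (*) Y h" using h by (simp add: topological_dual_norm_topology)
  have pos: "0 < n y" using False \<open>y \<in> Y\<close> norm_eq_0 norm_nonneg by (metis less_le)
  let ?c = "of_real (1 / n y) :: 'k"
  have c: "norm ?c = 1 / n y" using pos by (simp add: norm_divide)
  have "n (sc ?c y) = 1" unfolding norm_scale[OF \<open>y \<in> Y\<close>] c using pos by simp
  then have "norm (h (sc ?c y)) \<le> dual_norm Y n h"
    unfolding dual_norm_def by (intro cSUP_upper[OF _ bdd_above_dual_norm[OF h]]) (simp add: \<open>y \<in> Y\<close>)
  then have "1 / n y * norm (h y) \<le> dual_norm Y n h"
    by (simp only: linear_on_scale[OF lin \<open>y \<in> Y\<close>] norm_mult c)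
  then show ?thesis using pos by (simp add: field_simps)
qed

lemma dual_norm_nonneg:
  assumes "h \<in> topological_dual sc (norm_topology Y n)"
  shows "0 \<le> dual_norm Y n h"
proof -
  have "norm (h 0) \<le> dual_norm Y n h"
    unfolding dual_norm_def by (intro cSUP_upper bdd_above_dual_norm assms) auto
  then show ?thesis using norm_ge_zero order_trans by blast
qed

text \<open>Shaped for density arguments: approximating the data up to \<open>e\<close> leaves an
  error of a fixed constant times \<open>e\<close>.\<close>

lemma eq_if_norm_small:
  assumes "x \<in> Y" "y \<in> Y" "0 \<le> C" "\<And>e. 0 < e \<Longrightarrow> n (x - y) \<le> C * e"
  shows "x = y"
proof -
  have "n (x - y) \<le> 0"
  proof (rule field_le_epsilon)
    fix e :: real assume "0 < e"
    have "n (x - y) \<le> C * (e / (C + 1))" by (rule assms(4)) (use assms(3) \<open>0 < e\<close> in simp)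
    also have "\<dots> \<le> e" using assms(3) \<open>0 < e\<close> by (simp add: field_simps)
    finally show "n (x - y) \<le> 0 + e" by simp
  qed
  then show ?thesis using norm_eq_0[of "x - y"] norm_nonneg[of "x - y"] assms(1,2) by fastforce
qed

end

section \<open>Completeness and the extension of bounded operators from dense subspaces\<close>

locale banach_carrier = normed_carrier +
  assumes complete: "metric.mcomplete"
begin

lemma Cauchy_limit:
  assumes f: "\<And>i::nat. f i \<in> Y" and "\<And>e. 0 < e \<Longrightarrow> \<exists>N. \<forall>i\<ge>N. \<forall>j\<ge>N. n (f i - f j) < e"
  obtains l where "l \<in> Y" "(\<lambda>i. n (f i - l)) \<longlonglongrightarrow> 0"
proof -
  have "metric.MCauchy f"
    using assms unfolding metric.MCauchy_def by (auto simp: norm_dist_def)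
  then obtain l where "limitin (norm_topology Y n) f l sequentially"
    using complete unfolding metric.mcomplete_def norm_topology_def by meson
  then have "l \<in> Y \<and> (\<lambda>i. n (f i - l)) \<longlonglongrightarrow> 0"
    by (simp only: limitin_norm_topology[OF f])
  then show ?thesis by (intro that) auto
qed

end

lemma banach_space_on_iff: "banach_space_on sc Y n \<longleftrightarrow> banach_carrier sc Y n"
  by (simp only: banach_space_on_def banach_carrier_def normed_carrier_def banach_carrier_axioms_def)

text \<open>The bound \<open>C\<close> is an explicit argument so that an extension can be seen to
  keep the same constant. The domain \<open>D\<close> is separate from any complete carrier because
  the operators start out on a Frechet carrier measured in one norm of its scale.\<close>

definition bounded_linear_on ::
  "('k::real_normed_field \<Rightarrow> 'a::ab_group_add \<Rightarrow> 'a) \<Rightarrow> 'a set \<Rightarrow> ('a \<Rightarrow> real) \<Rightarrow>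
   ('k \<Rightarrow> 'b::ab_group_add \<Rightarrow> 'b) \<Rightarrow> 'b set \<Rightarrow> ('b \<Rightarrow> real) \<Rightarrow> real \<Rightarrow> ('a \<Rightarrow> 'b) \<Rightarrow> bool"
  where "bounded_linear_on sc1 D n sc2 Z m C T \<longleftrightarrow>
    linear_on sc1 sc2 D T \<and> T ` D \<subseteq> Z \<and> 0 \<le> C \<and> (\<forall>x\<in>D. m (T x) \<le> C * n x)"

locale dense_extension =
  dom: normed_carrier sc1 Y n + cod: banach_carrier sc2 Z m
  for sc1 :: "'k::real_normed_field \<Rightarrow> 'a::ab_group_add \<Rightarrow> 'a" and Y n
    and sc2 :: "'k \<Rightarrow> 'b::ab_group_add \<Rightarrow> 'b" and Z m +
  fixes D C T
  assumes D: "dom.subspace D" "D \<subseteq> Y" "norm_topology Y n closure_of D = Y"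
    and T: "bounded_linear_on sc1 D n sc2 Z m C T"
begin

lemma T_lin: "linear_on sc1 sc2 D T"
  and T_in: "\<And>d. d \<in> D \<Longrightarrow> T d \<in> Z"
  and C_nonneg: "0 \<le> C"
  and T_bound: "\<And>d. d \<in> D \<Longrightarrow> m (T d) \<le> C * n d"
  using T by (auto simp: bounded_linear_on_def)

lemma T_diff_bound:
  assumes "d \<in> D" "e \<in> D"
  shows "m (T d - T e) \<le> C * n (d - e)"
  using T_bound[of "d - e"] dom.linear_on_diff[OF T_lin D(1)] dom.subspace_diff[OF D(1)] assms
  by simp

lemma approx:
  assumes "x \<in> Y" "0 < e"
  obtains d where "d \<in> D" "d \<in> Y" "n (d - x) < e"
  using dom.closure_approx[OF D(3) assms] by blast

text \<open>The estimate characterises the value of the extension at \<open>x\<close> without choosing a sequence.\<close>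

lemma extension_value:
  assumes x: "x \<in> Y"
  shows "\<exists>z\<in>Z. \<forall>d\<in>D. m (T d - z) \<le> C * n (d - x)"
proof -
  obtain a where a: "\<And>i::nat. a i \<in> D" "\<And>i. a i \<in> Y" "(\<lambda>i. n (a i - x)) \<longlonglongrightarrow> 0"
    using dom.closure_seq[OF D(3) x] by blast
  have "\<exists>N. \<forall>i\<ge>N. \<forall>j\<ge>N. m (T (a i) - T (a j)) < e" if "0 < e" for e
  proof -
    \<comment> \<open>Two terms of the sequence are compared through \<open>x\<close>, so each may
      be off by half of \<open>e / (C + 1)\<close>.\<close>
    have "0 < e / (C + 1) / 2" using that C_nonneg by simp
    then obtain N where N: "\<And>i. i \<ge> N \<Longrightarrow> n (a i - x) < e / (C + 1) / 2"
      using order_tendstoD(2)[OF a(3)] unfolding eventually_sequentially by blast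
    have "m (T (a i) - T (a j)) < e" if "i \<ge> N" "j \<ge> N" for i j
    proof -
      have "n (a i - a j) \<le> n (a i - x) + n (a j - x)"
        using dom.norm_diff_triangle[of "a i" x "a j"] dom.norm_commute[of x "a j"] a x by simp
      then have *: "n (a i - a j) < e / (C + 1)"
        using N[OF that(1)] N[OF that(2)] by linarith
      have "m (T (a i) - T (a j)) \<le> C * n (a i - a j)" using T_diff_bound a by blast
      also have "\<dots> \<le> (C + 1) * n (a i - a j)" using a by (simp add: algebra_simps)
      also have "\<dots> < e" using * C_nonneg by (simp add: field_simps)
      finally show ?thesis .
    qed
    then show ?thesis by blast
  qed
  then obtain z where z: "z \<in> Z" "(\<lambda>i. m (T (a i) - z)) \<longlonglongrightarrow> 0"
    using cod.Cauchy_limit[of "\<lambda>i. T (a i)"] T_in a by blast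
  \<comment> \<open>Pass from \<open>T d\<close> to \<open>z\<close> through \<open>T (a i)\<close>
    and let \<open>i\<close> grow: the terms with \<open>a i\<close> vanish and
    \<open>C * n (d - x)\<close> remains.\<close>
  have "m (T d - z) \<le> C * n (d - x)" if d: "d \<in> D" for d
  proof (rule LIMSEQ_le_const)
    show "(\<lambda>i. C * (n (d - x) + n (a i - x)) + m (T (a i) - z)) \<longlonglongrightarrow> C * n (d - x)"
      using tendsto_add[OF tendsto_mult[OF tendsto_const[of C] tendsto_add[OF tendsto_const[of "n (d - x)"] a(3)]] z(2)]
      by simp
    have "m (T d - z) \<le> C * (n (d - x) + n (a i - x)) + m (T (a i) - z)" for i
    proof -
      have "m (T d - z) \<le> m (T d - T (a i)) + m (T (a i) - z)"
        using cod.norm_diff_triangle T_in a d z by blast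
      moreover have "m (T d - T (a i)) \<le> C * n (d - a i)"
        using T_diff_bound a d by blast
      moreover have "n (d - a i) \<le> n (d - x) + n (a i - x)"
        using dom.norm_diff_triangle[of d x "a i"] dom.norm_commute[of x "a i"] a x d D(2) by auto
      ultimately show ?thesis using mult_left_mono[OF _ C_nonneg] by fastforce
    qed
    then show "\<exists>N. \<forall>i\<ge>N. m (T d - z) \<le> C * (n (d - x) + n (a i - x)) + m (T (a i) - z)" by blast
  qed
  then show ?thesis using z by blast
qed

text \<open>The values are chosen independently at each point, so linearity has to be recovered:
  approximate the arguments from \<open>D\<close>, use linearity of \<open>T\<close> there, and
  bound every error by the estimate that characterises the values.\<close>

lemma bounded_extension:
  obtains T' where "bounded_linear_on sc1 Y n sc2 Z m C T'" "\<And>d. d \<in> D \<Longrightarrow> T' d = T d"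
proof -
  obtain T' where T'_in: "\<And>x. x \<in> Y \<Longrightarrow> T' x \<in> Z"
    and T': "\<And>x d. x \<in> Y \<Longrightarrow> d \<in> D \<Longrightarrow> m (T d - T' x) \<le> C * n (d - x)"
    using extension_value by metis
  have add: "T' (x + y) = T' x + T' y" if x: "x \<in> Y" and y: "y \<in> Y" for x y
  \<comment> \<open>Each of the two approximation errors, below \<open>e\<close>, is counted twice:
    once in the comparison at \<open>x + y\<close> and once at its own summand.\<close>
  proof (rule cod.eq_if_norm_small[of _ _ "4 * C"])
    fix e :: real assume "0 < e"
    obtain d where d: "d \<in> D" "d \<in> Y" "n (d - x) < e" using approx x \<open>0 < e\<close> by blast
    obtain d' where d': "d' \<in> D" "d' \<in> Y" "n (d' - y) < e" using approx y \<open>0 < e\<close> by blast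
    have dd: "d + d' \<in> D" using D(1) d d' dom.subspace_add by blast
    have T_add: "T (d + d') = T d + T d'" using linear_on_add[OF T_lin] d d' by blast
    have tri: "n ((d + d') - (x + y)) \<le> n (d - x) + n (d' - y)"
      using dom.norm_triangle[of "d - x" "d' - y"] d d' x y by (simp add: algebra_simps)
    have "m (T' (x + y) - (T' x + T' y))
        \<le> m (T' (x + y) - T (d + d')) + m ((T d - T' x) + (T d' - T' y))"
      using cod.norm_triangle[of "T' (x + y) - T (d + d')" "(T d - T' x) + (T d' - T' y)"]
        T_in[OF dd] T_in[OF d(1)] T_in[OF d'(1)] T'_in x y T_add by (simp add: algebra_simps)
    also have "\<dots> \<le> m (T (d + d') - T' (x + y)) + (m (T d - T' x) + m (T d' - T' y))"
      using cod.norm_triangle[of "T d - T' x" "T d' - T' y"] cod.norm_commute[of "T' (x + y)" "T (d + d')"]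
        T_in[OF dd] T_in[OF d(1)] T_in[OF d'(1)] T'_in x y by simp
    also have "\<dots> \<le> C * (n (d - x) + n (d' - y)) + (C * n (d - x) + C * n (d' - y))"
      using T'[of "x + y" "d + d'"] T'[OF x d(1)] T'[OF y d'(1)] dd x y mult_left_mono[OF tri C_nonneg]
      by (intro add_mono) auto
    also have "\<dots> = C * (2 * (n (d - x) + n (d' - y)))" by (simp add: algebra_simps)
    also have "\<dots> \<le> C * (4 * e)" using d(3) d'(3) C_nonneg by (intro mult_left_mono) auto
    finally show "m (T' (x + y) - (T' x + T' y)) \<le> 4 * C * e" by simp
  qed (use x y T'_in C_nonneg in auto)
  have scale: "T' (sc1 c x) = sc2 c (T' x)" if x: "x \<in> Y" for c x
  \<comment> \<open>The error, multiplied by \<open>norm c\<close>, occurs once at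
    \<open>sc1 c x\<close> and once at \<open>x\<close>.\<close>
  proof (rule cod.eq_if_norm_small[of _ _ "2 * C * norm c"])
    fix e :: real assume "0 < e"
    obtain d where d: "d \<in> D" "d \<in> Y" "n (d - x) < e" using approx x \<open>0 < e\<close> by blast
    have cd: "sc1 c d \<in> D" using D(1) d dom.subspace_scale by blast
    have T_scale: "T (sc1 c d) = sc2 c (T d)" using linear_on_scale[OF T_lin] d by blast
    have "m (T' (sc1 c x) - sc2 c (T' x))
        \<le> m (T' (sc1 c x) - T (sc1 c d)) + m (sc2 c (T d - T' x))"
      using cod.norm_triangle[of "T' (sc1 c x) - T (sc1 c d)" "sc2 c (T d - T' x)"]
        T_in[OF cd] T_in[OF d(1)] T'_in x T_scale by (simp add: cod.scale_right_diff_distrib)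
    also have "\<dots> = m (T (sc1 c d) - T' (sc1 c x)) + norm c * m (T d - T' x)"
      using cod.norm_commute[of "T' (sc1 c x)" "T (sc1 c d)"] cod.norm_scale[of "T d - T' x"]
        T_in[OF cd] T_in[OF d(1)] T'_in x by simp
    also have "\<dots> \<le> C * n (sc1 c d - sc1 c x) + norm c * (C * n (d - x))"
      using T'[of "sc1 c x" "sc1 c d"] T'[OF x d(1)] cd x by (intro add_mono mult_left_mono) auto
    also have "n (sc1 c d - sc1 c x) = norm c * n (d - x)"
      using dom.norm_scale[of "d - x" c] d x by (simp add: dom.scale_right_diff_distrib)
    also have "C * (norm c * n (d - x)) + norm c * (C * n (d - x)) = 2 * C * norm c * n (d - x)"
      by simp
    also have "\<dots> \<le> 2 * C * norm c * e" using d(3) C_nonneg by (intro mult_left_mono) auto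
    finally show "m (T' (sc1 c x) - sc2 c (T' x)) \<le> 2 * C * norm c * e" .
  qed (use x T'_in C_nonneg in auto)
  \<comment> \<open>At a point of \<open>D\<close> the estimate may be used with the point as its
    own approximant, and its right side is then 0.\<close>
  have eq: "T' d = T d" if d: "d \<in> D" for d
  proof -
    have "d \<in> Y" using d D(2) by blast
    then have "m (T d - T' d) = 0"
      using T'[of d d] cod.norm_nonneg[of "T d - T' d"] T_in T'_in d by fastforce
    then show ?thesis using cod.norm_eq_0[of "T d - T' d"] T_in T'_in d \<open>d \<in> Y\<close> by simp
  qed
  have bound: "m (T' x) \<le> C * n x" if x: "x \<in> Y" for x
  proof (rule field_le_epsilon)
    fix e :: real assume "0 < e"
    \<comment> \<open>The approximation error enters twice with factor \<open>C\<close>: through the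
      norm of \<open>d\<close> and through the distance of \<open>T d\<close> from
      \<open>T' x\<close>.\<close>
    then have "0 < e / (2 * (C + 1))" using C_nonneg by simp
    then obtain d where d: "d \<in> D" "d \<in> Y" "n (d - x) < e / (2 * (C + 1))" using approx x by blast
    have "m (T' x) \<le> m (T d) + m (T d - T' x)"
      using cod.norm_triangle[of "T d" "T' x - T d"] cod.norm_commute[of "T d" "T' x"]
        T_in[OF d(1)] T'_in x by simp
    also have "\<dots> \<le> C * (n x + n (d - x)) + C * n (d - x)"
      using T_bound[OF d(1)] T'[OF x d(1)] dom.norm_triangle[of x "d - x"] d x
        mult_left_mono[OF _ C_nonneg, of "n d" "n x + n (d - x)"] by simp
    also have "\<dots> = C * n x + 2 * C * n (d - x)" by (simp add: algebra_simps)
    also have "\<dots> \<le> C * n x + 2 * C * (e / (2 * (C + 1)))"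
      using d(3) C_nonneg by (intro add_left_mono mult_left_mono) auto
    also have "\<dots> \<le> C * n x + e" using C_nonneg \<open>0 < e\<close> by (simp add: field_simps)
    finally show "m (T' x) \<le> C * n x + e" .
  qed
  show ?thesis
    by (rule that[of T']) (use add scale T'_in C_nonneg bound eq in
      \<open>auto simp: bounded_linear_on_def linear_on_def\<close>)
qed

end

lemma limitin_bounded_linear_on:
  assumes "normed_space_on sc1 Y n" "normed_space_on sc2 Z m"
    and T: "bounded_linear_on sc1 Y n sc2 Z m C T"
    and f: "\<And>i. f i \<in> Y" and lim: "limitin (norm_topology Y n) f l sequentially"
  shows "limitin (norm_topology Z m) (\<lambda>i. T (f i)) (T l) sequentially"
proof -
  interpret dom: normed_carrier sc1 Y n by unfold_locales fact
  interpret cod: normed_carrier sc2 Z m by unfold_locales fact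
  have lin: "linear_on sc1 sc2 Y T" and T_in: "\<And>x. x \<in> Y \<Longrightarrow> T x \<in> Z"
    and bound: "\<And>x. x \<in> Y \<Longrightarrow> m (T x) \<le> C * n x"
    using T by (auto simp: bounded_linear_on_def)
  have l: "l \<in> Y" and *: "(\<lambda>i. n (f i - l)) \<longlonglongrightarrow> 0"
    using lim by (simp_all add: dom.limitin_norm_topology[OF f])
  have "(\<lambda>i. m (T (f i) - T l)) \<longlonglongrightarrow> 0"
  proof (rule tendsto_sandwich[OF _ _ tendsto_const])
    show "(\<lambda>i. C * n (f i - l)) \<longlonglongrightarrow> 0" using tendsto_mult_right_zero[OF *] .
    show "\<forall>\<^sub>F i in sequentially. 0 \<le> m (T (f i) - T l)" using T_in f l by simp
    show "\<forall>\<^sub>F i in sequentially. m (T (f i) - T l) \<le> C * n (f i - l)"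
      using bound[of "f _ - l"] f l dom.linear_on_diff[OF lin dom.subspace_carrier] by simp
  qed
  then show ?thesis using cod.limitin_norm_topology T_in f l by auto
qed

section \<open>CB-spaces, their duals and the Bessel property\<close>

lemma sum_canonical_vector:
  "(\<Sum>i<N. seq_scale (c i) (canonical_vector i)) k = (if k < N then c k else 0)"
  by (induction N) (auto simp: seq_scale_def canonical_vector_def less_Suc_eq)

locale CB_carrier =
  fixes Y :: "(nat \<Rightarrow> 'k::real_normed_field) set" and n
  assumes CB: "CB_space Y n"
begin

sublocale banach_carrier seq_scale Y n
  using CB by (simp add: CB_space_def BK_space_def banach_space_on_iff)

lemma canonical_vector_in: "canonical_vector i \<in> Y"
  using CB by (auto simp: CB_space_def schauder_basis_def)

lemma partial_sum_in: "(\<Sum>i<N. seq_scale (c i) (canonical_vector i)) \<in> Y"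
  using canonical_vector_in by (intro subspace_sum[OF subspace_carrier]) simp

lemma coordinate_in_dual: "(\<lambda>d. d i) \<in> topological_dual seq_scale (norm_topology Y n)"
  using CB by (auto simp: topological_dual_def CB_space_def BK_space_def linear_on_def seq_scale_def)

text \<open>The basis property provides some coefficients \<open>c\<close>. Since coordinate
  \<open>k\<close> is continuous, \<open>d k\<close> is the limit of the \<open>k\<close>-th
  coordinates of the partial sums, and these are eventually \<open>c k\<close>.\<close>

lemma coordinate_expansion:
  assumes "d \<in> Y"
  shows "limitin (norm_topology Y n) (\<lambda>N. \<Sum>i<N. seq_scale (d i) (canonical_vector i)) d sequentially"
proof -
  obtain c where c: "limitin (norm_topology Y n) (\<lambda>N. \<Sum>i<N. seq_scale (c i) (canonical_vector i)) d sequentially"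
    using CB assms unfolding CB_space_def schauder_basis_def by blast
  have "c k = d k" for k
  proof -
    have "continuous_map (norm_topology Y n) euclidean (\<lambda>d. d k)"
      using CB by (simp add: CB_space_def BK_space_def)
    from continuous_map_limit[OF this c]
    have "(\<lambda>N. if k < N then c k else 0) \<longlonglongrightarrow> d k"
      by (simp add: o_def sum_canonical_vector)
    \<comment> \<open>The sums run over \<open>i < N\<close>, so coordinate \<open>k\<close> is
      present from \<open>N = Suc k\<close> on.\<close>
    moreover have "(\<lambda>N. if k < N then c k else 0) \<longlonglongrightarrow> c k"
      by (rule tendsto_eventually) (auto simp: eventually_sequentially intro!: exI[of _ "Suc k"])
    ultimately show ?thesis using LIMSEQ_unique by blast
  qed
  then have "c = d" by blast
  then show ?thesis using c by simp
qed

text \<open>Both functionals agree on finite sums of canonical vectors, and continuity carries this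
  to the limit of the expansion.\<close>

lemma dual_eqI:
  assumes h: "h \<in> topological_dual seq_scale (norm_topology Y n)"
    and h': "h' \<in> topological_dual seq_scale (norm_topology Y n)"
    and eq: "\<And>i. h (canonical_vector i) = h' (canonical_vector i)" and "d \<in> Y"
  shows "h d = h' d"
proof -
  have lim: "(\<lambda>N. \<Sum>i<N. d i * u (canonical_vector i)) \<longlonglongrightarrow> u d"
    if "u \<in> topological_dual seq_scale (norm_topology Y n)" for u
  proof -
    have lin: "linear_on seq_scale (*) Y u" and cont: "continuous_map (norm_topology Y n) euclidean u"
      using that by (auto simp: topological_dual_def)
    show ?thesis
      using continuous_map_limit[OF cont coordinate_expansion[OF \<open>d \<in> Y\<close>]]
      by (simp add: o_def linear_on_sum[OF lin subspace_carrier canonical_vector_in])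
  qed
  show ?thesis using LIMSEQ_unique[OF lim[OF h]] lim[OF h'] by (simp add: eq)
qed

text \<open>The choice in \<open>dual_seq_norm\<close> may return a representative that differs from
  \<open>h\<close> outside \<open>Y\<close>; on \<open>Y\<close>, where \<open>dual_norm\<close>
  looks, the two coincide.\<close>

lemma dual_seq_norm_eq:
  assumes h: "h \<in> topological_dual seq_scale (norm_topology Y n)"
  shows "dual_seq_norm Y n (\<lambda>i. h (canonical_vector i)) = dual_norm Y n h"
proof -
  define h' where "h' = (SOME h'. h' \<in> topological_dual seq_scale (norm_topology Y n) \<and>
             (\<lambda>i. h' (canonical_vector i)) = (\<lambda>i. h (canonical_vector i)))"
  have "h' \<in> topological_dual seq_scale (norm_topology Y n) \<and>
             (\<lambda>i. h' (canonical_vector i)) = (\<lambda>i. h (canonical_vector i))"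
    unfolding h'_def by (rule someI[of _ h]) (simp add: h)
  then have "h' d = h d" if "d \<in> Y" for d
    using dual_eqI[OF _ h _ that] by (auto simp: fun_eq_iff)
  then show ?thesis
    unfolding dual_seq_norm_def h'_def[symmetric] dual_norm_def by (intro SUP_cong) auto
qed

end

text \<open>A functional \<open>u\<close> on \<open>Y\<close> pulls back along \<open>T\<close> to a
  functional on \<open>Z\<close> whose values at the canonical vectors are the required sequence;
  its dual norm grows by at most the factor \<open>C\<close>.\<close>

lemma dual_bessel_sequence_image:
  assumes CB: "CB_space Z m" and Y: "normed_space_on sc Y n"
    and T: "bounded_linear_on seq_scale Z m sc Y n C T"
  shows "dual_bessel_sequence sc Y n Z m (\<lambda>i. T (canonical_vector i))"
proof -
  interpret Z: CB_carrier Z m by unfold_locales fact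
  interpret Y: normed_carrier sc Y n by unfold_locales fact
  have T_in: "\<And>x. x \<in> Z \<Longrightarrow> T x \<in> Y" and "0 \<le> C" and T_bound: "\<And>x. x \<in> Z \<Longrightarrow> n (T x) \<le> C * m x"
    and T_lin: "linear_on seq_scale sc Z T"
    using T by (auto simp: bounded_linear_on_def)
  show ?thesis
    unfolding dual_bessel_sequence_def
  proof (intro exI[of _ C] ballI)
    fix u assume u: "u \<in> topological_dual sc (norm_topology Y n)"
    let ?h = "\<lambda>d. u (T d)"
    have u_lin: "linear_on sc (*) Y u" using u by (simp add: Y.topological_dual_norm_topology)
    have bound: "norm (?h d) \<le> C * dual_norm Y n u * m d" if d: "d \<in> Z" for d
    proof -
      have "norm (?h d) \<le> dual_norm Y n u * n (T d)" using Y.norm_le_dual_norm[OF u] T_in d by blast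
      also have "\<dots> \<le> dual_norm Y n u * (C * m d)"
        using T_bound[OF d] Y.dual_norm_nonneg[OF u] by (rule mult_left_mono)
      finally show ?thesis by (simp add: mult_ac)
    qed
    have nonneg: "0 \<le> C * dual_norm Y n u" using \<open>0 \<le> C\<close> Y.dual_norm_nonneg[OF u] by simp
    have "linear_on seq_scale (*) Z ?h"
      using T_lin u_lin T_in by (auto simp: linear_on_def)
    then have h: "?h \<in> topological_dual seq_scale (norm_topology Z m)"
      unfolding Z.topological_dual_norm_topology using bound nonneg by blast
    show "(\<lambda>i. u (T (canonical_vector i))) \<in> dual_seq_space Z m \<and>
        dual_seq_norm Z m (\<lambda>i. u (T (canonical_vector i))) \<le> C * dual_norm Y n u"
      using h Z.dual_seq_norm_eq[OF h] Z.dual_norm_le[of ?h, OF bound nonneg]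
      by (auto simp: dual_seq_space_def)
  qed
qed

section \<open>Admissible scales and continuity for the Frechet topology\<close>

locale scale_carrier =
  fixes sc :: "'k::real_normed_field \<Rightarrow> 'a::ab_group_add \<Rightarrow> 'a" and Y :: "nat \<Rightarrow> 'a set"
    and n :: "nat \<Rightarrow> 'a \<Rightarrow> real"
  assumes adm: "admissible_scale sc Y n"
begin

lemma banach_level: "banach_space_on sc (Y s) (n s)"
  and carrier_Suc: "Y (Suc s) \<subseteq> Y s"
  and norm_Suc: "x \<in> Y (Suc s) \<Longrightarrow> n s x \<le> n (Suc s) x"
  and frechet_carrier_dense: "norm_topology (Y s) (n s) closure_of frechet_carrier Y = Y s"
  using adm unfolding admissible_scale_def by blast+

sublocale level: banach_carrier sc "Y s" "n s" for s
  using banach_level by (simp only: banach_space_on_iff)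

lemma carrier_antimono: "s \<le> t \<Longrightarrow> Y t \<subseteq> Y s"
  by (rule lift_Suc_antimono_le[of Y, OF carrier_Suc])

lemma norm_mono:
  assumes "s \<le> t" "x \<in> Y t"
  shows "n s x \<le> n t x"
  using assms
proof (induction t rule: dec_induct)
  case (step t)
  have "x \<in> Y t" using carrier_Suc step.prems by blast
  then show ?case using step.IH norm_Suc[OF step.prems] by linarith
qed (rule order_refl)

lemma frechet_carrier_subset: "frechet_carrier Y \<subseteq> Y s"
  by (auto simp: frechet_carrier_def)

lemma frechet_subspace: "module.subspace sc (frechet_carrier Y)"
  unfolding frechet_carrier_def
proof (intro level.subspace_Inter ballI)
  fix S assume "S \<in> range Y"
  then obtain s where "S = Y s" by (rule rangeE)
  then show "module.subspace sc S" by (simp only: level.subspace_carrier)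
qed

lemma frechet_closed [simp]:
  "0 \<in> frechet_carrier Y"
  "x \<in> frechet_carrier Y \<Longrightarrow> y \<in> frechet_carrier Y \<Longrightarrow> x - y \<in> frechet_carrier Y"
  by (auto simp: frechet_carrier_def)

text \<open>The balls are only a subbasis, so a neighbourhood could a priori involve several norms.
  As the norms increase with the index, one of them suffices.\<close>

lemma openin_frechet_topology:
  assumes "openin (frechet_topology Y n) U" "x \<in> U"
  shows "\<exists>s e. 0 < e \<and> {y \<in> frechet_carrier Y. n s (y - x) < e} \<subseteq> U"
proof -
  have x: "x \<in> frechet_carrier Y"
    using subsetD[OF openin_subset[OF assms(1)] assms(2)]
    by (simp only: topspace_frechet_topology[OF adm])
  have "generate_topology_on {{y \<in> frechet_carrier Y. n s (y - x) < \<epsilon>} | s x \<epsilon>.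
      x \<in> frechet_carrier Y \<and> 0 < \<epsilon>} U"
    using assms(1) unfolding frechet_topology_def by (simp add: openin_topology_generated_by_iff)
  then show ?thesis using assms(2)
  proof induction
    case Empty
    then show ?case by simp
  next
    case (Int a b)
    obtain s e where s: "0 < e" "{y \<in> frechet_carrier Y. n s (y - x) < e} \<subseteq> a" using Int by blast
    obtain t d where t: "0 < d" "{y \<in> frechet_carrier Y. n t (y - x) < d} \<subseteq> b" using Int by blast
    \<comment> \<open>For an intersection, the larger index controls both norms and the smaller
      radius serves both sets.\<close>
    have "n s (y - x) \<le> n (max s t) (y - x)" "n t (y - x) \<le> n (max s t) (y - x)"
      if "y \<in> frechet_carrier Y" for y
      using norm_mono[of _ "max s t" "y - x"] subsetD[OF frechet_carrier_subset frechet_closed(2)[OF that x]]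
      by simp_all
    then have "{y \<in> frechet_carrier Y. n (max s t) (y - x) < min e d} \<subseteq> a \<inter> b"
      using s(2) t(2) by fastforce
    then show ?case using s(1) t(1) by (intro exI[of _ "max s t"] exI[of _ "min e d"]) simp
  next
    case (UN K)
    then obtain k where k: "k \<in> K" "x \<in> k" by blast
    then obtain s e where "0 < e" "{y \<in> frechet_carrier Y. n s (y - x) < e} \<subseteq> k" using UN by blast
    then show ?case using k(1) by blast
  next
    case (Basis b)
    then obtain s c e where b: "b = {y \<in> frechet_carrier Y. n s (y - c) < e}"
      and c: "c \<in> frechet_carrier Y"
      by blast
    have xc: "n s (x - c) < e" using Basis b by auto
    \<comment> \<open>A subbasic ball is centred at \<open>c\<close>; by the triangle inequality it
      contains a ball around \<open>x\<close> of the remaining radius.\<close>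
    have "{y \<in> frechet_carrier Y. n s (y - x) < e - n s (x - c)} \<subseteq> b"
    proof
      fix y assume y: "y \<in> {y \<in> frechet_carrier Y. n s (y - x) < e - n s (x - c)}"
      then have "n s (y - c) \<le> n s (y - x) + n s (x - c)"
        using x c frechet_carrier_subset by (intro level.norm_diff_triangle) blast+
      then show "y \<in> b" using y b by auto
    qed
    then show ?case using xc by (intro exI[of _ s] exI[of _ "e - n s (x - c)"]) simp
  qed
qed

end

text \<open>The preimage of the unit ball of \<open>m s\<close> is a neighbourhood of 0 and hence
  contains a ball of a single norm \<open>n r\<close>; homogeneity turns this inclusion into an
  inequality.\<close>

lemma frechet_continuous_bounded:
  assumes "admissible_scale sc1 Y n" "admissible_scale sc2 Z m"
    and lin: "linear_on sc1 sc2 (frechet_carrier Y) T"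
    and cont: "continuous_map (frechet_topology Y n) (frechet_topology Z m) T"
  shows "\<exists>r C. 0 < C \<and> (\<forall>x\<in>frechet_carrier Y. m s (T x) \<le> C * n r x)"
proof -
  interpret Y: scale_carrier sc1 Y n by unfold_locales fact
  interpret Z: scale_carrier sc2 Z m by unfold_locales fact
  have T_in: "T x \<in> frechet_carrier Z" if "x \<in> frechet_carrier Y" for x
    using cont that assms(1,2) by (auto simp: continuous_map_def topspace_frechet_topology)
  define U where "U = {z \<in> frechet_carrier Z. m s (z - 0) < 1}"
  have "openin (frechet_topology Z m) U"
    unfolding frechet_topology_def openin_topology_generated_by_iff U_def
    by (rule generate_topology_on.Basis) (use Z.frechet_closed(1) zero_less_one in blast)
  then have "openin (frechet_topology Y n) {x \<in> frechet_carrier Y. T x \<in> U}"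
    using openin_continuous_map_preimage[OF cont] topspace_frechet_topology[OF assms(1)] by simp
  moreover have "T 0 = 0" using Y.level.linear_on_0[OF lin Y.frechet_subspace] .
  then have "0 \<in> {x \<in> frechet_carrier Y. T x \<in> U}" by (simp add: U_def)
  ultimately obtain r e where e: "0 < e"
    and sub: "{y \<in> frechet_carrier Y. n r (y - 0) < e} \<subseteq> {x \<in> frechet_carrier Y. T x \<in> U}"
    using Y.openin_frechet_topology by blast
  have "m s (T x) \<le> 2 / e * n r x" if "x \<in> frechet_carrier Y" for x
  proof (rule Y.level.bounded_of_ball[OF Y.frechet_subspace Y.frechet_carrier_subset e _ _ that])
    show "m s (T (sc1 c x)) = norm c * m s (T x)" if "x \<in> frechet_carrier Y" for c x
    proof -
      have "T x \<in> Z s" using T_in[OF that] Z.frechet_carrier_subset by blast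
      then show ?thesis by (simp add: linear_on_scale[OF lin that] Z.level.norm_scale)
    qed
    show "m s (T x) < 1" if "x \<in> frechet_carrier Y" "n r x < e" for x
      using sub that by (auto simp: U_def)
  qed
  then show ?thesis using e by (intro exI[of _ r] exI[of _ "2 / e"]) simp
qed

section \<open>Index sequences, the frame expansion and the theorem\<close>

lemma increases_to_infinityI:
  assumes "mono r" "\<And>j. j \<le> r j"
  shows "increases_to_infinity r"
  using assms filterlim_at_top_mono[OF filterlim_ident, of r]
  by (simp add: increases_to_infinity_def)

text \<open>The identity \<open>V (U f) = f\<close> is given on the Frechet carrier only; density in
  \<open>X t\<close> spreads it to \<open>h\<close>, with errors measured in the weaker norm of
  \<open>X w\<close>. Boundedness then lets \<open>V\<close> act term by term on the coordinate
  expansion of \<open>U h\<close>.\<close>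

lemma frame_expansion:
  assumes X: "admissible_scale sc X nX" and "CB_space Z m"
    and t: "w \<le> t"
    and U: "bounded_linear_on sc (X t) (nX t) seq_scale Z m CU U"
    and V: "bounded_linear_on seq_scale Z m sc (X w) (nX w) CV V"
    and inv: "\<And>f. f \<in> frechet_carrier X \<Longrightarrow> V (U f) = f"
    and h: "h \<in> X t"
  shows "limitin (norm_topology (X w) (nX w)) (\<lambda>N. \<Sum>i<N. sc (U h i) (V (canonical_vector i))) h sequentially"
proof -
  interpret X: scale_carrier sc X nX by unfold_locales fact
  interpret Z: CB_carrier Z m by unfold_locales fact
  have U_lin: "linear_on sc seq_scale (X t) U" and U_in: "\<And>x. x \<in> X t \<Longrightarrow> U x \<in> Z" and "0 \<le> CU"
    and U_bound: "\<And>x. x \<in> X t \<Longrightarrow> m (U x) \<le> CU * nX t x"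
    using U by (auto simp: bounded_linear_on_def)
  have V_lin: "linear_on seq_scale sc Z V" and V_in: "\<And>x. x \<in> Z \<Longrightarrow> V x \<in> X w" and "0 \<le> CV"
    and V_bound: "\<And>x. x \<in> Z \<Longrightarrow> nX w (V x) \<le> CV * m x"
    using V by (auto simp: bounded_linear_on_def)
  have sub: "x \<in> X t \<Longrightarrow> x \<in> X w" for x using X.carrier_antimono[OF t] by blast
  have "V (U h) = h"
  \<comment> \<open>\<open>CV * CU\<close> bounds the error after applying both operators to
    \<open>h - d\<close>; the 1 accounts for \<open>d - h\<close> itself, as the norm of level
    \<open>w\<close> is at most that of level \<open>t\<close>.\<close>
  proof (rule X.level.eq_if_norm_small[of _ w _ "CV * CU + 1"])
    fix e :: real assume "0 < e"
    obtain d where d: "d \<in> frechet_carrier X" "d \<in> X t" "nX t (d - h) < e"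
      using X.level.closure_approx[OF X.frechet_carrier_dense h \<open>0 < e\<close>] by blast
    have "nX w (V (U h) - h) \<le> nX w (V (U h) - V (U d)) + nX w (d - h)"
      using X.level.norm_diff_triangle[of "V (U h)" w "V (U d)" h] inv[OF d(1)] V_in U_in h d sub by simp
    also have "V (U h) - V (U d) = V (U (h - d))"
      using X.level.linear_on_diff[OF U_lin X.level.subspace_carrier h d(2)]
        Z.linear_on_diff[OF V_lin Z.subspace_carrier U_in U_in] h d by simp
    also have "nX w (V (U (h - d))) \<le> CV * (CU * nX t (h - d))"
      using order_trans[OF V_bound mult_left_mono[OF U_bound \<open>0 \<le> CV\<close>]] U_in h d by simp
    also have "nX t (h - d) = nX t (d - h)" using X.level.norm_commute h d by blast
    also have "CV * (CU * nX t (d - h)) + nX w (d - h) \<le> (CV * CU + 1) * nX t (d - h)"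
      using X.norm_mono[OF t, of "d - h"] h d by (simp add: algebra_simps)
    also have "\<dots> \<le> (CV * CU + 1) * e"
      using d(3) \<open>0 \<le> CV\<close> \<open>0 \<le> CU\<close> by (intro mult_left_mono) auto
    finally show "nX w (V (U h) - h) \<le> (CV * CU + 1) * e" by simp
  qed (use V_in U_in h sub \<open>0 \<le> CV\<close> \<open>0 \<le> CU\<close> in auto)
  then show ?thesis
    using limitin_bounded_linear_on[OF Z.normed X.level.normed V Z.partial_sum_in
        Z.coordinate_expansion[OF U_in[OF h]]]
    by (simp add: Z.linear_on_sum[OF V_lin Z.subspace_carrier Z.canonical_vector_in])
qed

theorem theorem3p2:
  fixes sc :: "'k::{real_normed_field, banach} \<Rightarrow> 'a::ab_group_add \<Rightarrow> 'a"
    and X :: "nat \<Rightarrow> 'a set" and nX :: "nat \<Rightarrow> 'a \<Rightarrow> real"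
    and \<Theta> :: "nat \<Rightarrow> (nat \<Rightarrow> 'k) set" and n\<Theta> :: "nat \<Rightarrow> (nat \<Rightarrow> 'k) \<Rightarrow> real"
    and g :: "nat \<Rightarrow> 'a \<Rightarrow> 'k" and V :: "(nat \<Rightarrow> 'k) \<Rightarrow> 'a"
  assumes "admissible_scale sc X nX"
    and "admissible_scale seq_scale \<Theta> n\<Theta>"
    and "\<And>s. CB_space (\<Theta> s) (n\<Theta> s)"
    and "general_pre_frechet_frame sc X nX \<Theta> n\<Theta> g"
    and "linear_on seq_scale sc (frechet_carrier \<Theta>) V"
    and "continuous_map (frechet_topology \<Theta> n\<Theta>) (frechet_topology X nX) V"
    and "\<And>f. f \<in> frechet_carrier X \<Longrightarrow> V (\<lambda>i. g i f) = f"
  shows "\<exists>w r wt. increases_to_infinity w \<and> increases_to_infinity r \<and> increases_to_infinity wt \<and>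
    (\<exists>A B. (\<forall>j. 0 < A j \<and> 0 < B j) \<and>
      (\<forall>j. \<forall>f\<in>frechet_carrier X.
        A j * nX (w j) f \<le> n\<Theta> (r j) (\<lambda>i. g i f) \<and>
        n\<Theta> (r j) (\<lambda>i. g i f) \<le> B j * nX (wt j) f)) \<and>
    (\<exists>f. range f \<subseteq> frechet_carrier X \<and>
      (\<forall>j. dual_bessel_sequence sc (X (w j)) (nX (w j)) (\<Theta> (r j)) (n\<Theta> (r j)) f \<and>
        (\<exists>G. (\<forall>i. continuous_extension sc (frechet_carrier X)
                    (norm_topology (X (wt j)) (nX (wt j))) (g i) (G i)) \<and>
          (\<forall>h\<in>X (wt j). limitin (norm_topology (X (w j)) (nX (w j)))
             (\<lambda>N. \<Sum>i<N. sc (G i h) (f i)) h sequentially))))"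
proof -
  interpret X: scale_carrier sc X nX by unfold_locales fact
  interpret \<Theta>: scale_carrier seq_scale \<Theta> n\<Theta> by unfold_locales fact
  interpret \<Theta>_CB: CB_carrier "\<Theta> s" "n\<Theta> s" for s by unfold_locales fact
  let ?F = "frechet_carrier X" and ?E = "frechet_carrier \<Theta>"
  obtain st B0 where g_dual: "\<And>i. g i \<in> topological_dual sc (frechet_topology X nX)"
    and st: "increases_to_infinity st" and B0: "\<And>k. 0 < B0 k"
    and g_in: "\<And>f. f \<in> ?F \<Longrightarrow> (\<lambda>i. g i f) \<in> ?E"
    and g_bound: "\<And>f k. f \<in> ?F \<Longrightarrow> n\<Theta> k (\<lambda>i. g i f) \<le> B0 k * nX (st k) f"
    using assms(4) unfolding general_pre_frechet_frame_def by blast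
  have g_lin: "linear_on sc seq_scale ?F (\<lambda>f i. g i f)"
    using g_dual topspace_frechet_topology[OF assms(1)]
    by (auto simp: topological_dual_def linear_on_def fun_eq_iff seq_scale_def)
  have V_in: "V d \<in> ?F" if "d \<in> ?E" for d
    using assms(6) that topspace_frechet_topology[OF assms(1)] topspace_frechet_topology[OF assms(2)]
    by (auto simp: continuous_map_def)
  obtain r0 C where C: "\<And>s. 0 < C s" and V_bound0: "\<And>s d. d \<in> ?E \<Longrightarrow> nX s (V d) \<le> C s * n\<Theta> (r0 s) d"
    using frechet_continuous_bounded[OF assms(2,1,5,6)] by metis
  \<comment> \<open>Continuity of \<open>V\<close> gives no control on the growth of
    \<open>r0\<close>. The sum makes \<open>r\<close> monotone and at least \<open>r0\<close>, and
    the summand \<open>j\<close> forces it to infinity.\<close>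
  define r where "r j = j + (\<Sum>i\<le>j. r0 i)" for j
  \<comment> \<open>The index \<open>st (r j)\<close> comes from the upper frame inequality; the
    maximum with \<open>j\<close> ensures that \<open>X (wt j)\<close> lies in
    \<open>X j\<close>.\<close>
  define wt where "wt j = max j (st (r j))" for j
  have r: "increases_to_infinity r"
    by (rule increases_to_infinityI) (auto simp: r_def intro!: monoI add_mono sum_mono2)
  have "mono wt"
    using st r unfolding wt_def increases_to_infinity_def
    by (intro monoI max.mono) (auto dest: monoD)
  then have wt: "increases_to_infinity wt"
    by (rule increases_to_infinityI) (simp add: wt_def)
  have V_bound: "nX j (V d) \<le> C j * n\<Theta> (r j) d" if "d \<in> ?E" for j d
  proof -
    have "r0 j \<le> r j" using member_le_sum[of j "{..j}" r0] by (simp add: r_def)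
    then have "n\<Theta> (r0 j) d \<le> n\<Theta> (r j) d"
      using \<Theta>.norm_mono that \<Theta>.frechet_carrier_subset by blast
    then show ?thesis using V_bound0[OF that, of j] C[of j] mult_left_mono order_trans less_imp_le by metis
  qed
  have upper: "n\<Theta> (r j) (\<lambda>i. g i f) \<le> B0 (r j) * nX (wt j) f" if "f \<in> ?F" for j f
  proof -
    have "nX (st (r j)) f \<le> nX (wt j) f"
      using X.norm_mono[of "st (r j)" "wt j" f] that X.frechet_carrier_subset by (auto simp: wt_def)
    then show ?thesis using g_bound[OF that, of "r j"] B0[of "r j"] mult_left_mono order_trans less_imp_le by metis
  qed
  \<comment> \<open>Apply the bound on \<open>V\<close> to the coefficient sequence of
    \<open>f\<close>, which \<open>V\<close> sends back to \<open>f\<close>.\<close>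
  have lower: "1 / C j * nX j f \<le> n\<Theta> (r j) (\<lambda>i. g i f)" if "f \<in> ?F" for j f
    using V_bound[OF g_in[OF that], of j] assms(7)[OF that] C[of j] by (simp add: field_simps)
  \<comment> \<open>The canonical vectors lie in every \<open>\<Theta> s\<close>, so
    \<open>V\<close> itself is defined on them. One sequence in the Frechet carrier of
    \<open>X\<close> therefore serves all levels \<open>j\<close>.\<close>
  have e_in: "canonical_vector i \<in> ?E" for i
    using \<Theta>_CB.canonical_vector_in by (auto simp: frechet_carrier_def)
  define f where "f i = V (canonical_vector i)" for i
  have "dual_bessel_sequence sc (X j) (nX j) (\<Theta> (r j)) (n\<Theta> (r j)) f \<and>
        (\<exists>G. (\<forall>i. continuous_extension sc ?F (norm_topology (X (wt j)) (nX (wt j))) (g i) (G i)) \<and>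
          (\<forall>h\<in>X (wt j). limitin (norm_topology (X j) (nX j)) (\<lambda>N. \<Sum>i<N. sc (G i h) (f i)) h sequentially))"
    for j
  proof -
    have "bounded_linear_on sc ?F (nX (wt j)) seq_scale (\<Theta> (r j)) (n\<Theta> (r j)) (B0 (r j)) (\<lambda>f i. g i f)"
      using g_lin g_in \<Theta>.frechet_carrier_subset[of "r j"] upper B0[of "r j"]
      by (auto simp: bounded_linear_on_def)
    then interpret U: dense_extension sc "X (wt j)" "nX (wt j)" seq_scale "\<Theta> (r j)" "n\<Theta> (r j)"
      ?F "B0 (r j)" "\<lambda>f i. g i f"
      using X.frechet_subspace X.frechet_carrier_subset X.frechet_carrier_dense by unfold_locales
    obtain U where U: "bounded_linear_on sc (X (wt j)) (nX (wt j)) seq_scale (\<Theta> (r j)) (n\<Theta> (r j)) (B0 (r j)) U"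
      and U_eq: "\<And>f. f \<in> ?F \<Longrightarrow> U f = (\<lambda>i. g i f)"
      using U.bounded_extension by blast
    have "bounded_linear_on seq_scale ?E (n\<Theta> (r j)) sc (X j) (nX j) (C j) V"
      using assms(5) V_in X.frechet_carrier_subset[of j] V_bound C[of j]
      by (auto simp: bounded_linear_on_def)
    then interpret V: dense_extension seq_scale "\<Theta> (r j)" "n\<Theta> (r j)" sc "X j" "nX j" ?E "C j" V
      using \<Theta>.frechet_subspace \<Theta>.frechet_carrier_subset \<Theta>.frechet_carrier_dense by unfold_locales
    obtain V' where V': "bounded_linear_on seq_scale (\<Theta> (r j)) (n\<Theta> (r j)) sc (X j) (nX j) (C j) V'"
      and V'_eq: "\<And>d. d \<in> ?E \<Longrightarrow> V' d = V d"
      using V.bounded_extension by blast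
    \<comment> \<open>The extension \<open>V'\<close> depends on \<open>j\<close>, but its values at
      the canonical vectors do not.\<close>
    have f_eq: "f = (\<lambda>i. V' (canonical_vector i))" by (simp add: f_def V'_eq[OF e_in] fun_eq_iff)
    have bessel: "dual_bessel_sequence sc (X j) (nX j) (\<Theta> (r j)) (n\<Theta> (r j)) f"
      unfolding f_eq by (rule dual_bessel_sequence_image[OF assms(3) X.level.normed V'])
    \<comment> \<open>The extension of \<open>g i\<close> is coordinate \<open>i\<close> of
      \<open>U\<close>: it is bounded because coordinates are continuous on
      \<open>\<Theta> (r j)\<close>, and it agrees with \<open>g i\<close> where \<open>U\<close>
      agrees with the coefficient map.\<close>
    have G: "continuous_extension sc ?F (norm_topology (X (wt j)) (nX (wt j))) (g i) (\<lambda>h. U h i)" for i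
    proof -
      obtain c where c: "0 \<le> c" "\<And>d. d \<in> \<Theta> (r j) \<Longrightarrow> norm (d i) \<le> c * n\<Theta> (r j) d"
        using \<Theta>_CB.coordinate_in_dual[of i "r j"] unfolding \<Theta>.level.topological_dual_norm_topology by blast
      have "norm (U h i) \<le> c * B0 (r j) * nX (wt j) h" if "h \<in> X (wt j)" for h
      proof -
        have "norm (U h i) \<le> c * n\<Theta> (r j) (U h)" using c U that by (auto simp: bounded_linear_on_def)
        also have "\<dots> \<le> c * (B0 (r j) * nX (wt j) h)"
          using U that c(1) by (intro mult_left_mono) (auto simp: bounded_linear_on_def)
        finally show ?thesis by simp
      qed
      moreover have "0 \<le> c * B0 (r j)" using c(1) B0[of "r j"] by simp
      moreover have "linear_on sc (*) (X (wt j)) (\<lambda>h. U h i)"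
        using U by (auto simp: bounded_linear_on_def linear_on_def seq_scale_def)
      ultimately show ?thesis
        unfolding continuous_extension_def X.level.topological_dual_norm_topology
        using U_eq by auto
    qed
    have "limitin (norm_topology (X j) (nX j)) (\<lambda>N. \<Sum>i<N. sc (U h i) (f i)) h sequentially"
      if "h \<in> X (wt j)" for h
      unfolding f_eq
    proof (rule frame_expansion[OF assms(1,3) _ U V' _ that])
      show "j \<le> wt j" by (simp add: wt_def)
      show "V' (U x) = x" if "x \<in> ?F" for x
        using U_eq V'_eq g_in assms(7) that by simp
    qed
    then show ?thesis using bessel G by (intro conjI exI[of _ "\<lambda>i h. U h i"]) auto
  qed
  moreover have "range f \<subseteq> ?F" using V_in e_in by (auto simp: f_def)
  \<comment> \<open>The witness for \<open>w\<close> is the identity, since \<open>V\<close> was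
    bounded into each level \<open>X j\<close>.\<close>
  moreover have "increases_to_infinity (\<lambda>j. j)" by (intro increases_to_infinityI monoI order_refl)
  moreover have "\<exists>A B. (\<forall>j. 0 < A j \<and> 0 < B j) \<and> (\<forall>j. \<forall>f\<in>?F.
        A j * nX j f \<le> n\<Theta> (r j) (\<lambda>i. g i f) \<and> n\<Theta> (r j) (\<lambda>i. g i f) \<le> B j * nX (wt j) f)"
    using C B0 lower upper by (intro exI[of _ "\<lambda>j. 1 / C j"] exI[of _ "\<lambda>j. B0 (r j)"]) auto
  ultimately show ?thesis
    using r wt by (intro exI[of _ "\<lambda>j. j"] exI[of _ r] exI[of _ wt] conjI exI[of _ f] allI) auto
qed

end
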